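(* Let $S$ be a finite $2$-group. For every maximal subgroup $M<S$, there exists a unit $v_M\in B(S)^\times$ such that for $P\leq S$ one has $|v_M^P|=-1$ if and only if $P\leq M$. Moreover, $\mathrm{Aut}(S)$ acts on the set $\{v_M:M<S\text{ maximal}\}$ via $\alpha\cdot v_M=v_{\alpha(M)}$.
   Context: For a finite group $G$, $B(G)$ is the Burnside ring, i.e. the Grothendieck ring of finite left $G$-sets, with addition $[X]+[Y]=[X\sqcup Y]$ and multiplication $[X][Y]=[X\times Y]$. For $H\leq G$, the map $[X]\mapsto|X^H|$ extends to a ring morphism $B(G)\to\mathbb Z$, written $a\mapsto|a^H|$; the map $a\mapsto(|a^H|)_{H\leq G}$ is an injective ring morphism, so for a unit $u\in B(G)^\times$ all $|u^H|\in\{\pm1\}$, and $u$ is determined by these values. $\mathrm{Aut}(S)$ acts on $B(S)$ by ring automorphisms, where $\alpha\cdot[X]$ is the class of the $S$-set $X$ with action transported along $\alpha$ (i.e. $g$ acts as $\alpha^{-1}(g)$); equivalently $|(\alpha\cdot b)^Q|=|b^{\alpha^{-1}(Q)}|$ for $Q\leq S$. *)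

theory Defs
  imports "HOL-Algebra.Group_Action" "HOL-Algebra.Ring"
begin

section \<open>Finite G-sets\<close>

type_synonym ('g, 'x) gset = "'x set \<times> ('g \<Rightarrow> 'x \<Rightarrow> 'x)"

definition finite_gset :: "('g, 'm) monoid_scheme \<Rightarrow> ('g, 'x) gset \<Rightarrow> bool" where
  "finite_gset G X \<longleftrightarrow> finite (fst X) \<and> group_action G (fst X) (snd X)"

definition gset_iso :: "('g, 'm) monoid_scheme \<Rightarrow> ('g, 'x) gset \<Rightarrow> ('g, 'y) gset \<Rightarrow> bool" where
  "gset_iso G X Y \<longleftrightarrow>
     (\<exists>f. bij_betw f (fst X) (fst Y) \<and>
          (\<forall>g \<in> carrier G. \<forall>x \<in> fst X. f (snd X g x) = snd Y g (f x)))"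

text \<open>The restrictions below are needed because \<^const>\<open>group_action\<close> demands that every group
  element acts by an extensional function.\<close>

definition gset_empty :: "('g, 'x) gset" where
  "gset_empty = ({}, \<lambda>g. \<lambda>x \<in> {}. x)"

definition gset_point :: "('g, unit) gset" where
  "gset_point = (UNIV, \<lambda>g x. x)"

definition gset_sum :: "('g, 'x) gset \<Rightarrow> ('g, 'y) gset \<Rightarrow> ('g, 'x + 'y) gset" where
  "gset_sum X Y =
     (fst X <+> fst Y, \<lambda>g. \<lambda>z \<in> fst X <+> fst Y. map_sum (snd X g) (snd Y g) z)"

definition gset_prod :: "('g, 'x) gset \<Rightarrow> ('g, 'y) gset \<Rightarrow> ('g, 'x \<times> 'y) gset" where
  "gset_prod X Y =
     (fst X \<times> fst Y, \<lambda>g. \<lambda>z \<in> fst X \<times> fst Y. map_prod (snd X g) (snd Y g) z)"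

definition gset_fixed :: "'g set \<Rightarrow> ('g, 'x) gset \<Rightarrow> 'x set" where
  "gset_fixed H X = {x \<in> fst X. \<forall>h \<in> H. snd X h x = x}"

text \<open>Transport of the action along an automorphism: \<open>g\<close> acts as \<open>\<alpha>\<^sup>-\<^sup>1(g)\<close>.\<close>

definition gset_transport ::
    "('g, 'm) monoid_scheme \<Rightarrow> ('g \<Rightarrow> 'g) \<Rightarrow> ('g, 'x) gset \<Rightarrow> ('g, 'x) gset" where
  "gset_transport G \<alpha> X = (fst X, \<lambda>g. snd X (inv_into (carrier G) \<alpha> g))"


section \<open>The Burnside ring\<close>

text \<open>An element \<open>[X] - [Y]\<close> of the Grothendieck ring is the class of the pair \<open>(X, Y)\<close>, where
  \<open>(X, Y)\<close> and \<open>(X', Y')\<close> are identified iff \<open>X \<squnion> Y' \<squnion> Z \<cong> X' \<squnion> Y \<squnion> Z\<close> for some finite G-set \<open>Z\<close>.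
  Class members are restricted to G-sets whose points are natural numbers, which represent all
  isomorphism classes of finite G-sets (see \<open>finite_gset_nat_copy\<close> below); the G-sets \<open>X\<close>, \<open>Y\<close>
  in \<open>burnside_class G X Y\<close> may have points of any type.\<close>

type_synonym 'g burnside = "(('g, nat) gset \<times> ('g, nat) gset) set"

definition burnside_class ::
    "('g, 'm) monoid_scheme \<Rightarrow> ('g, 'x) gset \<Rightarrow> ('g, 'y) gset \<Rightarrow> 'g burnside" where
  "burnside_class G X Y =
     {(X', Y'). finite_gset G X' \<and> finite_gset G Y' \<and>
        (\<exists>Z :: ('g, nat) gset. finite_gset G Z \<and>
           gset_iso G (gset_sum (gset_sum X Y') Z) (gset_sum (gset_sum X' Y) Z))}"

definition burnside_ring :: "('g, 'm) monoid_scheme \<Rightarrow> 'g burnside ring" where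
  "burnside_ring G =
     \<lparr>carrier = {burnside_class G X Y | (X :: ('g, nat) gset) (Y :: ('g, nat) gset).
                   finite_gset G X \<and> finite_gset G Y},
      mult = (\<lambda>a b. \<Union>(X1, Y1) \<in> a. \<Union>(X2, Y2) \<in> b.
                burnside_class G (gset_sum (gset_prod X1 X2) (gset_prod Y1 Y2))
                                 (gset_sum (gset_prod X1 Y2) (gset_prod Y1 X2))),
      one = burnside_class G gset_point (gset_empty :: ('g, nat) gset),
      zero = burnside_class G (gset_empty :: ('g, nat) gset) (gset_empty :: ('g, nat) gset),
      add = (\<lambda>a b. \<Union>(X1, Y1) \<in> a. \<Union>(X2, Y2) \<in> b.
                burnside_class G (gset_sum X1 X2) (gset_sum Y1 Y2))\<rparr>"

text \<open>The mark \<open>|a\<^sup>H|\<close>, with \<open>|([X] - [Y])\<^sup>H| = |X\<^sup>H| - |Y\<^sup>H|\<close>; independence of the representative is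
  \<open>burnside_mark_class\<close> below.\<close>

definition burnside_mark :: "'g burnside \<Rightarrow> 'g set \<Rightarrow> int" where
  "burnside_mark a H =
     the_elem ((\<lambda>(X, Y). int (card (gset_fixed H X)) - int (card (gset_fixed H Y))) ` a)"

definition burnside_aut ::
    "('g, 'm) monoid_scheme \<Rightarrow> ('g \<Rightarrow> 'g) \<Rightarrow> 'g burnside \<Rightarrow> 'g burnside" where
  "burnside_aut G \<alpha> a =
     (\<Union>(X, Y) \<in> a. burnside_class G (gset_transport G \<alpha> X) (gset_transport G \<alpha> Y))"


section \<open>Maximal subgroups\<close>

definition maximal_subgroup :: "'g set \<Rightarrow> ('g, 'm) monoid_scheme \<Rightarrow> bool" where
  "maximal_subgroup M G \<longleftrightarrow>
     subgroup M G \<and> M \<noteq> carrier G \<and>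
     (\<forall>H. subgroup H G \<and> M \<subseteq> H \<longrightarrow> H = M \<or> H = carrier G)"


section \<open>Well-definedness\<close>

lemma gset_act_closed:
  assumes "finite_gset G X" "g \<in> carrier G" "x \<in> fst X"
  shows "snd X g x \<in> fst X"
proof -
  interpret group_action G "fst X" "snd X" using assms(1) by (simp add: finite_gset_def)
  show ?thesis using surj_prop[OF assms(2)] assms(3) by blast
qed

lemma finite_gset_nat_copy:
  assumes X: "finite_gset G X"
  shows "\<exists>X' :: ('g, nat) gset. finite_gset G X' \<and> gset_iso G (X :: ('g, 'x) gset) X'"
proof -
  interpret A: group_action G "fst X" "snd X" using X by (simp add: finite_gset_def)
  interpret G: group G using A.group_hom by (simp add: group_hom_def)
  obtain f :: "'x \<Rightarrow> nat" and n where f0: "f ` fst X = {i. i < n}" "inj_on f (fst X)"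
    using X finite_imp_inj_to_nat_seg[of "fst X"] unfolding finite_gset_def by blast
  define E where "E = {i. i < n}"
  define k where "k = inv_into (fst X) f"
  define \<psi> where "\<psi> = (\<lambda>g. \<lambda>i \<in> E. f (snd X g (k i)))"
  have f: "bij_betw f (fst X) E" using f0 by (simp add: bij_betw_def E_def)
  have k: "bij_betw k E (fst X)" unfolding k_def by (rule bij_betw_inv_into[OF f])
  have kE: "k i \<in> fst X" if "i \<in> E" for i using k that by (auto simp: bij_betw_def)
  have kf: "k (f x) = x" if "x \<in> fst X" for x
    using that f by (simp add: k_def bij_betw_inv_into_left)
  have fE: "f x \<in> E" if "x \<in> fst X" for x using f that by (auto simp: bij_betw_def)
  have act: "snd X g x \<in> fst X" if "g \<in> carrier G" "x \<in> fst X" for g x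
    using gset_act_closed[OF X] that .
  have Bij: "\<psi> g \<in> Bij E" if g: "g \<in> carrier G" for g
  proof -
    have "bij_betw (snd X g) (fst X) (fst X)" using A.bij_prop0[OF g] by (simp add: Bij_def)
    from bij_betw_trans[OF bij_betw_trans[OF k this] f] have "bij_betw (f \<circ> (snd X g \<circ> k)) E E" .
    moreover have "bij_betw (\<psi> g) E E \<longleftrightarrow> bij_betw (f \<circ> (snd X g \<circ> k)) E E"
      by (rule bij_betw_cong) (simp add: \<psi>_def)
    ultimately have "bij_betw (\<psi> g) E E" by simp
    then show ?thesis by (simp add: Bij_def \<psi>_def)
  qed
  have "\<psi> \<in> hom G (BijGroup E)"
  proof (rule homI)
    fix g assume "g \<in> carrier G"
    then show "\<psi> g \<in> carrier (BijGroup E)" by (simp add: BijGroup_def Bij)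
  next
    fix g h assume gh: "g \<in> carrier G" "h \<in> carrier G"
    have "\<psi> (g \<otimes>\<^bsub>G\<^esub> h) = compose E (\<psi> g) (\<psi> h)"
    proof
      fix i
      show "\<psi> (g \<otimes>\<^bsub>G\<^esub> h) i = compose E (\<psi> g) (\<psi> h) i"
      proof (cases "i \<in> E")
        case True
        then show ?thesis
          using A.composition_rule[OF kE[OF True] gh] act[OF gh(2) kE[OF True]]
          by (simp add: \<psi>_def compose_def fE kf)
      qed (simp add: \<psi>_def compose_def)
    qed
    then show "\<psi> (g \<otimes>\<^bsub>G\<^esub> h) = \<psi> g \<otimes>\<^bsub>BijGroup E\<^esub> \<psi> h"
      using Bij[OF gh(1)] Bij[OF gh(2)] by (simp add: BijGroup_def)
  qed
  then have "group_action G E \<psi>"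
    by (simp add: group_action_def group_hom_def group_hom_axioms_def G.is_group group_BijGroup)
  then have "finite_gset G (E, \<psi>)" by (simp add: finite_gset_def E_def)
  moreover have "gset_iso G X (E, \<psi>)"
    unfolding gset_iso_def using f by (auto simp: \<psi>_def fE kf)
  ultimately show ?thesis by blast
qed

lemma card_fixed_iso:
  assumes "finite_gset G X" "gset_iso G X Y" "H \<subseteq> carrier G"
  shows "card (gset_fixed H X) = card (gset_fixed H Y)"
proof -
  obtain f where f: "bij_betw f (fst X) (fst Y)"
    and eq: "\<forall>g \<in> carrier G. \<forall>x \<in> fst X. f (snd X g x) = snd Y g (f x)"
    using assms(2) unfolding gset_iso_def by blast
  have "snd X h x = x \<longleftrightarrow> snd Y h (f x) = f x" if "h \<in> H" "x \<in> fst X" for h x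
  proof -
    have "h \<in> carrier G" using that assms(3) by blast
    then have "snd X h x \<in> fst X" "f (snd X h x) = snd Y h (f x)"
      using gset_act_closed[OF assms(1)] that eq by auto
    then show ?thesis using f that by (metis bij_betw_def inj_onD)
  qed
  then have iff: "f x \<in> gset_fixed H Y \<longleftrightarrow> x \<in> gset_fixed H X" if "x \<in> fst X" for x
    using f that unfolding gset_fixed_def bij_betw_def by blast
  have "gset_fixed H X \<subseteq> fst X" "gset_fixed H Y \<subseteq> f ` fst X"
    using f by (auto simp: gset_fixed_def bij_betw_def)
  with iff have "gset_fixed H Y = f ` gset_fixed H X" by blast
  moreover have "inj_on f (gset_fixed H X)"
    by (rule inj_on_subset[of f "fst X"]) (use f in \<open>auto simp: gset_fixed_def bij_betw_def\<close>)
  ultimately show ?thesis by (simp add: card_image)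
qed

lemma finite_gset_sum:
  assumes X: "finite_gset G X" and Y: "finite_gset G Y"
  shows "finite_gset G (gset_sum X Y)"
proof -
  interpret A: group_action G "fst X" "snd X" using X by (simp add: finite_gset_def)
  interpret B: group_action G "fst Y" "snd Y" using Y by (simp add: finite_gset_def)
  interpret G: group G using A.group_hom by (simp add: group_hom_def)
  define E where "E = fst X <+> fst Y"
  define \<psi> where "\<psi> = (\<lambda>g. \<lambda>z \<in> E. map_sum (snd X g) (snd Y g) z)"
  have Bij: "\<psi> g \<in> Bij E" if g: "g \<in> carrier G" for g
  proof -
    have a: "bij_betw (snd X g) (fst X) (fst X)" "bij_betw (snd Y g) (fst Y) (fst Y)"
      using A.bij_prop0[OF g] B.bij_prop0[OF g] by (simp_all add: Bij_def)
    then have "inj_on (map_sum (snd X g) (snd Y g)) E"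
      unfolding E_def bij_betw_def by (auto intro!: inj_onI dest: inj_onD)
    moreover have "map_sum (snd X g) (snd Y g) ` E = snd X g ` fst X <+> snd Y g ` fst Y"
      by (force simp: E_def)
    ultimately have "bij_betw (map_sum (snd X g) (snd Y g)) E E"
      using a by (simp add: bij_betw_def E_def)
    moreover have "bij_betw (\<psi> g) E E \<longleftrightarrow> bij_betw (map_sum (snd X g) (snd Y g)) E E"
      by (rule bij_betw_cong) (simp add: \<psi>_def)
    ultimately show ?thesis by (simp add: Bij_def \<psi>_def)
  qed
  have "\<psi> \<in> hom G (BijGroup E)"
  proof (rule homI)
    fix g assume "g \<in> carrier G"
    then show "\<psi> g \<in> carrier (BijGroup E)" by (simp add: BijGroup_def Bij)
  next
    fix g h assume gh: "g \<in> carrier G" "h \<in> carrier G"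
    have "\<psi> (g \<otimes>\<^bsub>G\<^esub> h) = compose E (\<psi> g) (\<psi> h)"
    proof
      fix z
      show "\<psi> (g \<otimes>\<^bsub>G\<^esub> h) z = compose E (\<psi> g) (\<psi> h) z"
        using A.composition_rule[OF _ gh] B.composition_rule[OF _ gh]
          gset_act_closed[OF X gh(2)] gset_act_closed[OF Y gh(2)]
        by (cases z) (auto simp: \<psi>_def compose_def E_def)
    qed
    then show "\<psi> (g \<otimes>\<^bsub>G\<^esub> h) = \<psi> g \<otimes>\<^bsub>BijGroup E\<^esub> \<psi> h"
      using Bij[OF gh(1)] Bij[OF gh(2)] by (simp add: BijGroup_def)
  qed
  then have "group_action G E \<psi>"
    by (simp add: group_action_def group_hom_def group_hom_axioms_def G.is_group group_BijGroup)
  moreover have "finite E" using X Y by (simp add: E_def finite_gset_def)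
  moreover have "gset_sum X Y = (E, \<psi>)" by (simp add: gset_sum_def E_def \<psi>_def)
  ultimately show ?thesis by (simp add: finite_gset_def)
qed

lemma card_fixed_sum:
  assumes "finite_gset G X" "finite_gset G Y"
  shows "card (gset_fixed H (gset_sum X Y)) = card (gset_fixed H X) + card (gset_fixed H Y)"
proof -
  have "gset_fixed H (gset_sum X Y) = gset_fixed H X <+> gset_fixed H Y"
    by (auto simp: gset_fixed_def gset_sum_def)
  moreover have "finite (gset_fixed H X)" "finite (gset_fixed H Y)"
    using assms by (auto simp: gset_fixed_def finite_gset_def)
  ultimately show ?thesis by (simp add: card_Plus)
qed

lemma burnside_class_nonempty:
  fixes X :: "('g, 'x) gset" and Y :: "('g, 'y) gset"
  assumes X: "finite_gset G X" and Y: "finite_gset G Y"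
  shows "burnside_class G X Y \<noteq> {}"
proof -
  obtain X' Y' :: "('g, nat) gset"
    where X': "finite_gset G X'" "gset_iso G X X'" and Y': "finite_gset G Y'" "gset_iso G Y Y'"
    using finite_gset_nat_copy[OF X] finite_gset_nat_copy[OF Y] by blast
  obtain f where f: "bij_betw f (fst X) (fst X')"
    "\<forall>g \<in> carrier G. \<forall>x \<in> fst X. f (snd X g x) = snd X' g (f x)"
    using X'(2) unfolding gset_iso_def by blast
  obtain k where k: "bij_betw k (fst Y) (fst Y')"
    "\<forall>g \<in> carrier G. \<forall>x \<in> fst Y. k (snd Y g x) = snd Y' g (k x)"
    using Y'(2) unfolding gset_iso_def by blast
  define l where "l = inv_into (fst Y) k"
  have kl: "bij_betw l (fst Y') (fst Y)" unfolding l_def by (rule bij_betw_inv_into[OF k(1)])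
  have lact: "l (snd Y' g y) = snd Y g (l y)" if g: "g \<in> carrier G" and y: "y \<in> fst Y'" for g y
  proof -
    have ly: "l y \<in> fst Y" using kl y by (auto simp: bij_betw_def)
    have kly: "k (l y) = y" using k(1) y by (simp add: l_def bij_betw_inv_into_right)
    have "k (snd Y g (l y)) = snd Y' g y" using k(2) g ly kly by simp
    moreover have "snd Y g (l y) \<in> fst Y" using gset_act_closed[OF Y g ly] .
    ultimately show ?thesis using bij_betw_inv_into_left[OF k(1), of "snd Y g (l y)"] by (simp add: l_def)
  qed
  define m where "m = map_sum (map_sum f l) (id :: nat \<Rightarrow> nat)"
  have inj: "inj_on m ((fst X <+> fst Y') <+> fst X')"
    using f(1) kl unfolding m_def bij_betw_def by (auto intro!: inj_onI dest: inj_onD)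
  have "m ` ((fst X <+> fst Y') <+> fst X') = (f ` fst X <+> l ` fst Y') <+> fst X'"
    by (force simp: m_def)
  then have "bij_betw m ((fst X <+> fst Y') <+> fst X') ((fst X' <+> fst Y) <+> fst X')"
    using inj f(1) kl by (simp add: bij_betw_def)
  moreover have "m (snd (gset_sum (gset_sum X Y') X') g z) = snd (gset_sum (gset_sum X' Y) X') g (m z)"
    if "g \<in> carrier G" "z \<in> (fst X <+> fst Y') <+> fst X'" for g z
  proof -
    have fX: "f x \<in> fst X'" if "x \<in> fst X" for x using f(1) that by (auto simp: bij_betw_def)
    have lY: "l y \<in> fst Y" if "y \<in> fst Y'" for y using kl that by (auto simp: bij_betw_def)
    note act = gset_act_closed[OF X that(1)] gset_act_closed[OF Y that(1)]
      gset_act_closed[OF X'(1) that(1)] gset_act_closed[OF Y'(1) that(1)]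
    consider x where "z = Inl (Inl x)" "x \<in> fst X" | y where "z = Inl (Inr y)" "y \<in> fst Y'"
      | w where "z = Inr w" "w \<in> fst X'"
      using \<open>z \<in> _\<close> by blast
    then show ?thesis
    proof cases
      case 1 with that(1) f(2) fX act show ?thesis by (simp add: m_def gset_sum_def InlI InrI)
    next
      case 2 with lact that(1) lY act show ?thesis by (simp add: m_def gset_sum_def InlI InrI)
    next
      case 3 with act show ?thesis by (simp add: m_def gset_sum_def InlI InrI)
    qed
  qed
  ultimately have "gset_iso G (gset_sum (gset_sum X Y') X') (gset_sum (gset_sum X' Y) X')"
    unfolding gset_iso_def by (intro exI[of _ m]) (simp add: gset_sum_def)
  then have "(X', Y') \<in> burnside_class G X Y"
    unfolding burnside_class_def using X'(1) Y'(1) by blast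
  then show ?thesis by blast
qed

lemma burnside_mark_class:
  fixes X :: "('g, 'x) gset" and Y :: "('g, 'y) gset"
  assumes X: "finite_gset G X" and Y: "finite_gset G Y" and H: "H \<subseteq> carrier G"
  shows "burnside_mark (burnside_class G X Y) H =
           int (card (gset_fixed H X)) - int (card (gset_fixed H Y))"
proof -
  let ?d = "int (card (gset_fixed H X)) - int (card (gset_fixed H Y))"
  have "int (card (gset_fixed H X')) - int (card (gset_fixed H Y')) = ?d"
    if cls: "(X', Y') \<in> burnside_class G X Y" for X' Y' :: "('g, nat) gset"
  proof -
    obtain Z :: "('g, nat) gset" where Z: "finite_gset G Z"
      "gset_iso G (gset_sum (gset_sum X Y') Z) (gset_sum (gset_sum X' Y) Z)"
      and X'Y': "finite_gset G X'" "finite_gset G Y'"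
      using cls unfolding burnside_class_def by blast
    have "card (gset_fixed H (gset_sum (gset_sum X Y') Z)) =
          card (gset_fixed H (gset_sum (gset_sum X' Y) Z))"
      by (rule card_fixed_iso[OF _ Z(2) H]) (intro finite_gset_sum X X'Y' Z)
    then show ?thesis
      by (simp add: card_fixed_sum[of G] finite_gset_sum X Y X'Y' Z(1))
  qed
  then have "(\<lambda>(X', Y'). int (card (gset_fixed H X')) - int (card (gset_fixed H Y')))
                ` burnside_class G X Y = (\<lambda>_. ?d) ` burnside_class G X Y"
    by (intro image_cong) auto
  also have "\<dots> = {?d}" by (simp add: image_constant_conv burnside_class_nonempty[OF X Y])
  finally show ?thesis by (simp add: burnside_mark_def)
qed

end

(* The unit is v_M = 1 - [S/M]: as S is a 2-group, M has index two, so [S/M] has mark 2 at subgroups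
   of M and mark 0 elsewhere. By Burnside's theorem the marks determine an element of B(S); since
   units have marks 1 and -1 only, the condition on v_M leaves a single possibility, and alpha . v_M
   is identified with v_(alpha(M)) by comparing marks. *)

theory Submission
  imports Defs "HOL-Computational_Algebra.Primes" "HOL-Algebra.Multiplicative_Group"
begin

section \<open>Restrictions, products and transports of G-sets\<close>

text \<open>Ring elements are sets of pairs of G-sets, and both the product and the action of
  automorphisms are unions over representatives, so each identity in \<open>burnside_ring\<close> is
  an equality of such sets. Burnside's theorem reduces it to an equality of integer functions on
  subgroups: equal marks give an isomorphism, so the auxiliary summand in the definition of a class
  may be taken empty, and a class is the set of all pairs with prescribed differences of marks.
  Index two is where the order of S enters: a proper subgroup of a group of prime power order is
  normalized by an element outside it, found by counting fixed points modulo the prime. Index two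
  gives \<open>[S/M]^2 = 2 [S/M]\<close>, so v_M squares to 1 and is its own inverse.\<close>

lemma group_actionI:
  assumes "group G"
    and closed: "\<And>g x. g \<in> carrier G \<Longrightarrow> x \<in> E \<Longrightarrow> \<phi> g x \<in> E"
    and one: "\<And>x. x \<in> E \<Longrightarrow> \<phi> \<one>\<^bsub>G\<^esub> x = x"
    and mult: "\<And>g h x. g \<in> carrier G \<Longrightarrow> h \<in> carrier G \<Longrightarrow> x \<in> E \<Longrightarrow> \<phi> (g \<otimes>\<^bsub>G\<^esub> h) x = \<phi> g (\<phi> h x)"
    and ext: "\<And>g. g \<in> carrier G \<Longrightarrow> \<phi> g \<in> extensional E"
  shows "group_action G E \<phi>"
proof -
  interpret group G by fact
  have Bij: "\<phi> g \<in> Bij E" if g: "g \<in> carrier G" for g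
  proof -
    \<comment> \<open>The action of the inverse element is the inverse map, so the algebraic laws
      alone give bijectivity.\<close>
    have "bij_betw (\<phi> g) E E"
    proof (rule bij_betw_byWitness[where f' = "\<phi> (inv\<^bsub>G\<^esub> g)"])
      show "\<forall>x\<in>E. \<phi> (inv\<^bsub>G\<^esub> g) (\<phi> g x) = x"
        using mult[of "inv\<^bsub>G\<^esub> g" g] g one by simp
      show "\<forall>x\<in>E. \<phi> g (\<phi> (inv\<^bsub>G\<^esub> g) x) = x"
        using mult[of g "inv\<^bsub>G\<^esub> g"] g one by simp
    qed (use closed g in auto)
    then show ?thesis using ext g by (simp add: Bij_def)
  qed
  have "\<phi> \<in> hom G (BijGroup E)"
  proof (rule homI)
    fix g h assume gh: "g \<in> carrier G" "h \<in> carrier G"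
    have "\<phi> (g \<otimes>\<^bsub>G\<^esub> h) = compose E (\<phi> g) (\<phi> h)"
      by (rule extensionalityI[of _ E]) (use gh mult ext in \<open>auto simp: compose_def\<close>)
    then show "\<phi> (g \<otimes>\<^bsub>G\<^esub> h) = \<phi> g \<otimes>\<^bsub>BijGroup E\<^esub> \<phi> h"
      using Bij gh by (simp add: BijGroup_def)
  qed (simp add: BijGroup_def Bij)
  then show ?thesis
    by (simp add: group_action_def group_hom_def group_hom_axioms_def is_group group_BijGroup)
qed

lemma
  assumes "finite_gset G X"
  shows gset_group: "group G"
    and gset_finite: "finite (fst X)"
    and gset_act_one: "x \<in> fst X \<Longrightarrow> snd X \<one>\<^bsub>G\<^esub> x = x"
    and gset_act_mult: "g \<in> carrier G \<Longrightarrow> h \<in> carrier G \<Longrightarrow> x \<in> fst X \<Longrightarrow>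
          snd X (g \<otimes>\<^bsub>G\<^esub> h) x = snd X g (snd X h x)"
    and gset_act_inv: "g \<in> carrier G \<Longrightarrow> x \<in> fst X \<Longrightarrow> snd X (inv\<^bsub>G\<^esub> g) (snd X g x) = x"
    and gset_act_ext: "g \<in> carrier G \<Longrightarrow> snd X g \<in> extensional (fst X)"
proof -
  interpret group_action G "fst X" "snd X" using assms by (simp add: finite_gset_def)
  show "group G" using group_hom by (simp add: group_hom_def)
  show "finite (fst X)" using assms by (simp add: finite_gset_def)
  show "snd X \<one>\<^bsub>G\<^esub> x = x" if "x \<in> fst X" using that id_eq_one by (metis restrict_apply')
  show "snd X (g \<otimes>\<^bsub>G\<^esub> h) x = snd X g (snd X h x)"
    if "g \<in> carrier G" "h \<in> carrier G" "x \<in> fst X" using composition_rule that by simp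
  show "snd X (inv\<^bsub>G\<^esub> g) (snd X g x) = x" if "g \<in> carrier G" "x \<in> fst X"
    using orbit_sym_aux that by simp
  show "snd X g \<in> extensional (fst X)" if "g \<in> carrier G"
    using bij_prop0[OF that] by (simp add: Bij_def)
qed

section \<open>Cutting a G-set along an invariant subset and gluing it back\<close>

definition gset_restrict :: "'x set \<Rightarrow> ('g, 'x) gset \<Rightarrow> ('g, 'x) gset" where
  "gset_restrict A X = (A, \<lambda>g. restrict (snd X g) A)"

lemma fst_gset_restrict [simp]: "fst (gset_restrict A X) = A"
  by (simp add: gset_restrict_def)

lemma finite_gset_restrict:
  assumes X: "finite_gset G X" and A: "A \<subseteq> fst X"
    and closed: "\<And>g x. g \<in> carrier G \<Longrightarrow> x \<in> A \<Longrightarrow> snd X g x \<in> A"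
  shows "finite_gset G (gset_restrict A X)"
proof -
  interpret group G using gset_group[OF X] .
  have "group_action G A (\<lambda>g. restrict (snd X g) A)"
    using A closed
    by (intro group_actionI is_group) (auto simp: gset_act_one[OF X] gset_act_mult[OF X] subset_iff)
  then show ?thesis
    using finite_subset[OF A gset_finite[OF X]] by (simp add: finite_gset_def gset_restrict_def)
qed

lemma gset_fixed_restrict: "gset_fixed H (gset_restrict A X) = {x \<in> A. \<forall>h\<in>H. snd X h x = x}"
  by (auto simp: gset_fixed_def gset_restrict_def)

lemma card_fixed_split:
  assumes "finite (fst X)" "A \<subseteq> fst X"
  shows "card (gset_fixed H X) =
    card (gset_fixed H (gset_restrict A X)) + card (gset_fixed H (gset_restrict (fst X - A) X))"
proof -
  have "gset_fixed H X =
      gset_fixed H (gset_restrict A X) \<union> gset_fixed H (gset_restrict (fst X - A) X)"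
    using assms(2) unfolding gset_fixed_restrict by (auto simp: gset_fixed_def)
  moreover have "finite A" using assms finite_subset by blast
  ultimately show ?thesis
    using assms by (simp add: gset_fixed_restrict card_Un_disjoint disjoint_iff)
qed

lemma gset_iso_restrictE:
  assumes "gset_iso G (gset_restrict A X) (gset_restrict B Y)"
    and "\<And>g x. g \<in> carrier G \<Longrightarrow> x \<in> A \<Longrightarrow> snd X g x \<in> A"
  obtains f where "bij_betw f A B"
    "\<And>g x. g \<in> carrier G \<Longrightarrow> x \<in> A \<Longrightarrow> f (snd X g x) = snd Y g (f x)"
proof -
  obtain f where f: "bij_betw f A B"
    "\<forall>g\<in>carrier G. \<forall>x\<in>A. f (restrict (snd X g) A x) = restrict (snd Y g) B (f x)"
    using assms(1) by (auto simp: gset_iso_def gset_restrict_def)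
  have "f (snd X g x) = snd Y g (f x)" if "g \<in> carrier G" "x \<in> A" for g x
    using f that bij_betwE[OF f(1)] by force
  with f(1) show ?thesis by (rule that)
qed

text \<open>Both pieces are invariant, so no group element leads from the domain of one isomorphism
  into that of the other, and the map defined by cases is equivariant. This reattaches an orbit that
  was split off.\<close>

lemma gset_iso_glue:
  assumes A: "A \<subseteq> fst X" "\<And>g x. g \<in> carrier G \<Longrightarrow> x \<in> A \<Longrightarrow> snd X g x \<in> A"
    and A': "\<And>g x. g \<in> carrier G \<Longrightarrow> x \<in> fst X - A \<Longrightarrow> snd X g x \<in> fst X - A"
    and B: "B \<subseteq> fst Y"
    and iso: "gset_iso G (gset_restrict A X) (gset_restrict B Y)"
      "gset_iso G (gset_restrict (fst X - A) X) (gset_restrict (fst Y - B) Y)"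
  shows "gset_iso G X Y"
proof -
  obtain f where f: "bij_betw f A B"
    "\<And>g x. g \<in> carrier G \<Longrightarrow> x \<in> A \<Longrightarrow> f (snd X g x) = snd Y g (f x)"
    using gset_iso_restrictE[OF iso(1) A(2)] by blast
  obtain k where k: "bij_betw k (fst X - A) (fst Y - B)"
    "\<And>g x. g \<in> carrier G \<Longrightarrow> x \<in> fst X - A \<Longrightarrow> k (snd X g x) = snd Y g (k x)"
    using gset_iso_restrictE[OF iso(2) A'] by blast
  define m where "m = (\<lambda>x. if x \<in> A then f x else k x)"
  have "bij_betw m A B" using f(1) by (simp add: m_def cong: bij_betw_cong)
  moreover have "bij_betw m (fst X - A) (fst Y - B)"
    using k(1) by (rule bij_betw_cong[THEN iffD1, rotated]) (simp add: m_def)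
  ultimately have "bij_betw m (A \<union> (fst X - A)) (B \<union> (fst Y - B))"
    by (rule bij_betw_combine) auto
  then have "bij_betw m (fst X) (fst Y)" using A(1) B by (simp add: Un_absorb1)
  moreover have "m (snd X g x) = snd Y g (m x)" if "g \<in> carrier G" "x \<in> fst X" for g x
    using that A(2) A' f(2) k(2) by (cases "x \<in> A") (auto simp: m_def)
  ultimately show ?thesis unfolding gset_iso_def by blast
qed

lemma finite_gset_empty: "group G \<Longrightarrow> finite_gset G gset_empty"
  unfolding finite_gset_def gset_empty_def by (auto intro!: group_actionI)

lemma finite_gset_point: "group G \<Longrightarrow> finite_gset G gset_point"
  unfolding finite_gset_def gset_point_def by (auto intro!: group_actionI)

lemma finite_gset_prod:
  assumes X: "finite_gset G X" and Y: "finite_gset G Y"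
  shows "finite_gset G (gset_prod X Y)"
proof -
  interpret group G using gset_group[OF X] .
  have "group_action G (fst X \<times> fst Y)
      (\<lambda>g. \<lambda>z \<in> fst X \<times> fst Y. map_prod (snd X g) (snd Y g) z)"
    by (rule group_actionI)
      (auto simp: is_group gset_act_one[OF X] gset_act_mult[OF X] gset_act_closed[OF X]
        gset_act_one[OF Y] gset_act_mult[OF Y] gset_act_closed[OF Y])
  then show ?thesis
    using X Y by (simp add: finite_gset_def gset_prod_def)
qed

section \<open>Automorphisms and transported actions\<close>

lemma auto_inverse:
  assumes "group G" "\<alpha> \<in> auto G"
  shows "restrict (inv_into (carrier G) \<alpha>) (carrier G) \<in> auto G"
  using group.restrict_inv_into_hom[OF assms(1)] assms(2) restrict_inv_into_Bij
  by (auto simp: auto_def)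

lemma auto_subgroup_image:
  assumes "group G" "\<alpha> \<in> auto G" "subgroup H G"
  shows "subgroup (\<alpha> ` H) G"
proof -
  have "group_hom G G \<alpha>"
    using assms by (simp add: group_hom_def group_hom_axioms_def auto_def)
  then show ?thesis using group_hom.subgroup_img_is_subgroup assms(3) by blast
qed

text \<open>The inverse map belongs to \<open>auto G\<close> only after restriction to the carrier,
  and on a subgroup this restriction changes nothing.\<close>

lemma auto_subgroup_vimage:
  assumes "group G" "\<alpha> \<in> auto G" "subgroup H G"
  shows "subgroup (inv_into (carrier G) \<alpha> ` H) G"
proof -
  have "restrict (inv_into (carrier G) \<alpha>) (carrier G) ` H = inv_into (carrier G) \<alpha> ` H"
    using subgroup.subset[OF assms(3)] by (auto simp: subset_iff image_iff)
  then show ?thesis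
    using auto_subgroup_image[OF assms(1) auto_inverse[OF assms(1,2)] assms(3)] by simp
qed

lemma finite_gset_transport:
  assumes X: "finite_gset G X" and \<alpha>: "\<alpha> \<in> auto G"
  shows "finite_gset G (gset_transport G \<alpha> X)"
proof -
  interpret group G using gset_group[OF X] .
  let ?\<beta> = "inv_into (carrier G) \<alpha>"
  have "restrict ?\<beta> (carrier G) \<in> hom G G"
    using auto_inverse[OF is_group \<alpha>] by (simp add: auto_def)
  then have \<beta>: "?\<beta> g \<in> carrier G" "?\<beta> (g \<otimes>\<^bsub>G\<^esub> h) = ?\<beta> g \<otimes>\<^bsub>G\<^esub> ?\<beta> h"
    if "g \<in> carrier G" "h \<in> carrier G" for g h
    using that hom_in_carrier[of _ G G] hom_mult[of _ G G] by fastforce+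
  \<comment> \<open>An idempotent element of a group is the unit.\<close>
  have "?\<beta> \<one>\<^bsub>G\<^esub> = \<one>\<^bsub>G\<^esub>"
    using \<beta>[of "\<one>\<^bsub>G\<^esub>" "\<one>\<^bsub>G\<^esub>"] by (metis l_cancel_one one_closed r_one)
  then have "group_action G (fst X) (\<lambda>g. snd X (?\<beta> g))"
    by (intro group_actionI)
      (auto simp: is_group \<beta> gset_act_one[OF X] gset_act_mult[OF X] gset_act_closed[OF X]
        gset_act_ext[OF X])
  then show ?thesis using X by (simp add: finite_gset_def gset_transport_def)
qed

section \<open>Marks of the basic constructions\<close>

lemma card_fixed_empty: "card (gset_fixed H gset_empty) = 0"
  by (simp add: gset_fixed_def gset_empty_def)

lemma card_fixed_point: "card (gset_fixed H gset_point) = 1"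
  by (simp add: gset_fixed_def gset_point_def UNIV_unit)

lemma card_fixed_prod:
  "card (gset_fixed H (gset_prod X Y)) = card (gset_fixed H X) * card (gset_fixed H Y)"
proof -
  have "gset_fixed H (gset_prod X Y) = gset_fixed H X \<times> gset_fixed H Y"
    by (auto simp: gset_fixed_def gset_prod_def)
  then show ?thesis by (simp add: card_cartesian_product)
qed

lemma gset_fixed_transport:
  "gset_fixed H (gset_transport G \<alpha> X) = gset_fixed (inv_into (carrier G) \<alpha> ` H) X"
  by (simp add: gset_fixed_def gset_transport_def)


section \<open>Marks determine finite G-sets\<close>

lemma stabilizer_fixes: "x \<in> fst X \<Longrightarrow> x \<in> gset_fixed (stabilizer G (snd X) x) X"
  by (simp add: gset_fixed_def stabilizer_def)

lemma fixed_le_stabilizer: "x \<in> gset_fixed H X \<Longrightarrow> H \<subseteq> carrier G \<Longrightarrow> H \<subseteq> stabilizer G (snd X) x"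
  by (auto simp: gset_fixed_def stabilizer_def)

text \<open>Acting by the inverse would carry a point that enters the orbit back to where it came
  from, so none can enter from outside. Hence the complement is a G-set too, and an orbit can be
  split off.\<close>

lemma
  assumes X: "finite_gset G X" and x: "x \<in> fst X"
  shows orbit_subset: "orbit G (snd X) x \<subseteq> fst X"
    and orbit_closed: "\<And>g z. g \<in> carrier G \<Longrightarrow> z \<in> orbit G (snd X) x \<Longrightarrow> snd X g z \<in> orbit G (snd X) x"
    and orbit_complement_closed: "\<And>g z. g \<in> carrier G \<Longrightarrow> z \<in> fst X - orbit G (snd X) x \<Longrightarrow>
          snd X g z \<in> fst X - orbit G (snd X) x"
proof -
  interpret group G using gset_group[OF X] .
  show "orbit G (snd X) x \<subseteq> fst X"
    using x by (auto simp: orbit_def gset_act_closed[OF X])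
  show closed: "snd X g z \<in> orbit G (snd X) x"
    if "g \<in> carrier G" "z \<in> orbit G (snd X) x" for g z
    using that x unfolding orbit_def by (auto simp flip: gset_act_mult[OF X])
  show "snd X g z \<in> fst X - orbit G (snd X) x"
    if g: "g \<in> carrier G" and z: "z \<in> fst X - orbit G (snd X) x" for g z
  proof -
    have "snd X (inv\<^bsub>G\<^esub> g) (snd X g z) = z" using gset_act_inv[OF X g] z by simp
    then have "snd X g z \<notin> orbit G (snd X) x"
      using closed[of "inv\<^bsub>G\<^esub> g" "snd X g z"] g z by auto
    then show ?thesis using gset_act_closed[OF X g] z by simp
  qed
qed

text \<open>The orbit of \<open>x\<close> is a copy of the left cosets of its stabilizer;
  coincidences of points in it depend on the stabilizer alone.\<close>

lemma stabilizer_eq_iff: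
  assumes X: "finite_gset G X" and x: "x \<in> fst X" and gh: "g \<in> carrier G" "h \<in> carrier G"
  shows "snd X g x = snd X h x \<longleftrightarrow> inv\<^bsub>G\<^esub> g \<otimes>\<^bsub>G\<^esub> h \<in> stabilizer G (snd X) x"
proof -
  interpret group G using gset_group[OF X] .
  have "snd X (inv\<^bsub>G\<^esub> g \<otimes>\<^bsub>G\<^esub> h) x = snd X (inv\<^bsub>G\<^esub> g) (snd X h x)"
    using gh x by (simp add: gset_act_mult[OF X])
  moreover have "snd X g (snd X (inv\<^bsub>G\<^esub> g) (snd X h x)) = snd X h x"
    using gset_act_inv[OF X, of "inv\<^bsub>G\<^esub> g" "snd X h x"] gh x gset_act_closed[OF X gh(2) x] by simp
  ultimately show ?thesis
    using gh gset_act_inv[OF X gh(1) x] by (auto simp: stabilizer_def)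
qed

lemma orbit_iso:
  assumes X: "finite_gset G X" and Y: "finite_gset G Y" and x: "x \<in> fst X" and y: "y \<in> fst Y"
    and stab: "stabilizer G (snd X) x = stabilizer G (snd Y) y"
  shows "gset_iso G (gset_restrict (orbit G (snd X) x) X) (gset_restrict (orbit G (snd Y) y) Y)"
proof -
  interpret group G using gset_group[OF X] .
  \<comment> \<open>The map sends \<open>g x\<close> to \<open>g y\<close>. Equal stabilizers make
    it independent of the chosen \<open>g\<close>, and injective by the same equivalence.\<close>
  define f where "f z = snd Y (SOME g. g \<in> carrier G \<and> snd X g x = z) y" for z
  have same: "snd X g x = snd X h x \<longleftrightarrow> snd Y g y = snd Y h y"
    if "g \<in> carrier G" "h \<in> carrier G" for g h
    using that by (simp add: stabilizer_eq_iff[OF X x] stabilizer_eq_iff[OF Y y] stab)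
  have f: "f (snd X g x) = snd Y g y" if "g \<in> carrier G" for g
  proof -
    let ?h = "SOME h. h \<in> carrier G \<and> snd X h x = snd X g x"
    have "?h \<in> carrier G \<and> snd X ?h x = snd X g x"
      using that someI[of "\<lambda>h. h \<in> carrier G \<and> snd X h x = snd X g x" g] by blast
    then show ?thesis using same that unfolding f_def by blast
  qed
  have "bij_betw f (orbit G (snd X) x) (orbit G (snd Y) y)"
  proof (rule bij_betw_imageI)
    show "inj_on f (orbit G (snd X) x)"
      by (auto simp: inj_on_def orbit_def f same)
    show "f ` orbit G (snd X) x = orbit G (snd Y) y"
      by (force simp: orbit_def f)
  qed
  moreover have "f (snd X g z) = snd Y g (f z)"
    if "g \<in> carrier G" "z \<in> orbit G (snd X) x" for g z
    using that x y by (auto simp: orbit_def f gset_act_mult[OF X, symmetric] gset_act_mult[OF Y, symmetric])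
  ultimately show ?thesis
    unfolding gset_iso_def by (intro exI[of _ f]) (auto simp: gset_restrict_def bij_betwE)
qed

text \<open>An orbit with a stabilizer of maximal order occurs in both G-sets, and can be split off.\<close>

theorem gset_iso_if_marks_eq:
  assumes G: "finite (carrier G)" and "finite_gset G X" "finite_gset G Y"
    and "\<And>H. subgroup H G \<Longrightarrow> card (gset_fixed H X) = card (gset_fixed H Y)"
  shows "gset_iso G X Y"
  using assms(2-)
proof (induction "card (fst X)" arbitrary: X Y rule: less_induct)
  case less
  note X = less.prems(1) and Y = less.prems(2) and marks = less.prems(3)
  interpret group G using gset_group[OF X] .
  interpret A: group_action G "fst X" "snd X" using X by (simp add: finite_gset_def)
  interpret B: group_action G "fst Y" "snd Y" using Y by (simp add: finite_gset_def)
  show ?case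
  proof (cases "fst X = {}")
    case True
    \<comment> \<open>The mark at the trivial subgroup counts all points.\<close>
    have "gset_fixed {\<one>\<^bsub>G\<^esub>} Y = fst Y"
      by (auto simp: gset_fixed_def gset_act_one[OF Y])
    moreover have "card (gset_fixed {\<one>\<^bsub>G\<^esub>} X) = 0"
      using True by (simp add: gset_fixed_def)
    ultimately have "fst Y = {}"
      using marks[OF triv_subgroup] gset_finite[OF Y] by simp
    then show ?thesis using True by (auto simp: gset_iso_def bij_betw_def)
  next
    case False
    let ?stX = "stabilizer G (snd X)" and ?stY = "stabilizer G (snd Y)"
    \<comment> \<open>Whether a subgroup has a fixed point can be read off its mark. Finiteness
      matters, since \<open>card\<close> is also 0 on infinite sets.\<close>
    have transfer: "gset_fixed H X \<noteq> {} \<longleftrightarrow> gset_fixed H Y \<noteq> {}" if "subgroup H G" for H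
    proof -
      have "finite (gset_fixed H X)" "finite (gset_fixed H Y)"
        using gset_finite[OF X] gset_finite[OF Y] by (auto simp: gset_fixed_def)
      then show ?thesis using marks[OF that] by (metis card_0_eq)
    qed
    obtain x where x: "x \<in> fst X" and max: "\<And>z. z \<in> fst X \<Longrightarrow> card (?stX z) \<le> card (?stX x)"
    proof -
      let ?I = "(\<lambda>z. card (?stX z)) ` fst X"
      have I: "finite ?I" "?I \<noteq> {}" using False gset_finite[OF X] by simp_all
      obtain x where "x \<in> fst X" "card (?stX x) = Max ?I" using Max_in[OF I] by auto
      then show ?thesis using that Max_ge[OF I(1)] by simp
    qed
    \<comment> \<open>Passing to \<open>Y\<close> and back gives
      \<open>?stX x \<subseteq> ?stY y \<subseteq> ?stX z\<close>; the maximal order of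
      \<open>?stX x\<close> turns the first inclusion into an equality.\<close>
    obtain y where y: "y \<in> gset_fixed (?stX x) Y"
      using transfer[OF A.stabilizer_subgroup[OF x]] stabilizer_fixes[OF x] by blast
    then have yY: "y \<in> fst Y" by (simp add: gset_fixed_def)
    have le: "?stX x \<subseteq> ?stY y"
      by (rule fixed_le_stabilizer[OF y]) (auto simp: stabilizer_def)
    obtain z where z: "z \<in> gset_fixed (?stY y) X"
      using transfer[OF B.stabilizer_subgroup[OF yY]] stabilizer_fixes[OF yY] by blast
    have "?stY y \<subseteq> ?stX z"
      by (rule fixed_le_stabilizer[OF z]) (auto simp: stabilizer_def)
    moreover have fin: "finite (?stX z)" "finite (?stY y)"
      by (rule finite_subset[OF _ G], force simp: stabilizer_def)+
    ultimately have "card (?stY y) \<le> card (?stX x)"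
      using max[of z] z card_mono[of "?stX z" "?stY y"] by (simp add: gset_fixed_def)
    then have stab: "?stX x = ?stY y" using le fin(2) by (simp add: card_seteq)
    let ?A = "orbit G (snd X) x" and ?B = "orbit G (snd Y) y"
    let ?X' = "gset_restrict (fst X - ?A) X" and ?Y' = "gset_restrict (fst Y - ?B) Y"
    note oX = orbit_subset[OF X x] orbit_closed[OF X x] orbit_complement_closed[OF X x]
    note oY = orbit_subset[OF Y yY] orbit_closed[OF Y yY] orbit_complement_closed[OF Y yY]
    have iso: "gset_iso G (gset_restrict ?A X) (gset_restrict ?B Y)"
      by (rule orbit_iso[OF X Y x yY stab])
    have "gset_iso G ?X' ?Y'"
    proof (rule less.hyps)
      have "x \<in> ?A" using A.orbit_refl[OF x] .
      then have "fst X - ?A \<subset> fst X" using x by blast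
      then show "card (fst ?X') < card (fst X)"
        using gset_finite[OF X] by (simp add: psubset_card_mono)
      show "finite_gset G ?X'" using finite_gset_restrict[OF X _ oX(3)] by simp
      show "finite_gset G ?Y'" using finite_gset_restrict[OF Y _ oY(3)] by simp
      fix H assume H: "subgroup H G"
      \<comment> \<open>The removed orbits are isomorphic, so their marks cancel and the remainders
        again have equal marks.\<close>
      have "card (gset_fixed H (gset_restrict ?A X)) = card (gset_fixed H (gset_restrict ?B Y))"
        by (rule card_fixed_iso[OF finite_gset_restrict[OF X oX(1,2)] iso subgroup.subset[OF H]])
      then show "card (gset_fixed H ?X') = card (gset_fixed H ?Y')"
        using marks[OF H] card_fixed_split[OF gset_finite[OF X] oX(1)]
          card_fixed_split[OF gset_finite[OF Y] oY(1)] by simp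
    qed
    with oX oY(1) iso show ?thesis by (rule gset_iso_glue)
  qed
qed


section \<open>Elements of the Burnside ring as classes of equal marks\<close>

text \<open>Marks serve as coordinates on the Burnside ring. Values of \<open>\<phi>\<close> away
  from subgroups are ignored, and the set is empty when no difference of finite G-sets has these
  marks.\<close>

definition marks_class :: "('g, 'm) monoid_scheme \<Rightarrow> ('g set \<Rightarrow> int) \<Rightarrow> 'g burnside" where
  "marks_class G \<phi> = {(X, Y). finite_gset G X \<and> finite_gset G Y \<and>
     (\<forall>H. subgroup H G \<longrightarrow> int (card (gset_fixed H X)) - int (card (gset_fixed H Y)) = \<phi> H)}"

lemma marks_class_cong:
  "(\<And>H. subgroup H G \<Longrightarrow> \<phi> H = \<psi> H) \<Longrightarrow> marks_class G \<phi> = marks_class G \<psi>"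
  by (auto simp: marks_class_def)

text \<open>Fixed points are counted additively, so the summand \<open>Z\<close> of the definition
  cancels and members have the right marks. Conversely, equal marks already yield an isomorphism,
  and \<open>Z\<close> can be empty.\<close>

lemma burnside_class_eq_marks_class:
  assumes G: "finite (carrier G)" and X: "finite_gset G X" and Y: "finite_gset G Y"
  shows "burnside_class G X Y =
    marks_class G (\<lambda>H. int (card (gset_fixed H X)) - int (card (gset_fixed H Y)))"
    (is "?l = ?r")
proof (intro subset_antisym subrelI)
  fix A B assume "(A, B) \<in> ?l"
  then obtain Z :: "('a, nat) gset" where A: "finite_gset G A" "finite_gset G B" and Z: "finite_gset G Z"
    and iso: "gset_iso G (gset_sum (gset_sum X B) Z) (gset_sum (gset_sum A Y) Z)"
    unfolding burnside_class_def by blast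
  have "int (card (gset_fixed H A)) - int (card (gset_fixed H B)) =
        int (card (gset_fixed H X)) - int (card (gset_fixed H Y))" if "subgroup H G" for H
    using card_fixed_iso[OF _ iso subgroup.subset[OF that]]
    by (simp add: card_fixed_sum[of G] finite_gset_sum X Y A Z)
  then show "(A, B) \<in> ?r" using A by (simp add: marks_class_def)
next
  fix A B assume "(A, B) \<in> ?r"
  then have A: "finite_gset G A" "finite_gset G B"
    and eq: "\<And>H. subgroup H G \<Longrightarrow> int (card (gset_fixed H A)) - int (card (gset_fixed H B)) =
        int (card (gset_fixed H X)) - int (card (gset_fixed H Y))"
    by (auto simp: marks_class_def)
  let ?Z = "gset_empty :: ('a, nat) gset"
  have Z: "finite_gset G ?Z" using finite_gset_empty[OF gset_group[OF X]] .
  have "gset_iso G (gset_sum (gset_sum X B) ?Z) (gset_sum (gset_sum A Y) ?Z)"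
  proof (rule gset_iso_if_marks_eq[OF G])
    fix H assume "subgroup H G"
    from eq[OF this]
    show "card (gset_fixed H (gset_sum (gset_sum X B) ?Z)) =
        card (gset_fixed H (gset_sum (gset_sum A Y) ?Z))"
      by (simp add: card_fixed_sum[of G] finite_gset_sum X Y A Z)
  qed (intro finite_gset_sum X Y A Z)+
  then show "(A, B) \<in> ?l" using A Z unfolding burnside_class_def by blast
qed

text \<open>The carrier is built from G-sets on natural numbers; any member of the class is such a
  pair and has the same differences of marks. This admits G-sets with other points, such as
  booleans.\<close>

lemma burnside_class_in_carrier:
  assumes G: "finite (carrier G)" and X: "finite_gset G X" and Y: "finite_gset G Y"
  shows "burnside_class G X Y \<in> carrier (burnside_ring G)"
proof -
  obtain A B where AB: "(A, B) \<in> burnside_class G X Y"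
    using burnside_class_nonempty[OF X Y] by auto
  then have "burnside_class G X Y = burnside_class G A B"
    unfolding burnside_class_eq_marks_class[OF G X Y]
    by (subst burnside_class_eq_marks_class[OF G])
      (auto simp: marks_class_def intro!: marks_class_cong)
  moreover have "finite_gset G A" "finite_gset G B" using AB by (auto simp: burnside_class_def)
  ultimately show ?thesis
    unfolding burnside_ring_def partial_object.select_convs by blast
qed

lemma burnside_carrierE:
  assumes "a \<in> carrier (burnside_ring G)"
  obtains X Y :: "('g, nat) gset"
  where "finite_gset G X" "finite_gset G Y" "a = burnside_class G X Y"
  using assms by (auto simp: burnside_ring_def)

text \<open>This is injectivity of the mark homomorphism, in the form in which elements are compared
  later.\<close>

lemma burnside_eq_marks_class:
  assumes G: "finite (carrier G)" and a: "a \<in> carrier (burnside_ring G)"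
  shows "a = marks_class G (burnside_mark a)"
proof -
  obtain X Y :: "('a, nat) gset"
    where XY: "finite_gset G X" "finite_gset G Y" and "a = burnside_class G X Y"
    using burnside_carrierE[OF a] .
  then show ?thesis
    using burnside_mark_class[OF XY subgroup.subset]
    by (simp add: burnside_class_eq_marks_class[OF G XY] cong: marks_class_cong)
qed

text \<open>A union of a constant set over representatives equals that set only if there is a
  representative.\<close>

lemma burnside_carrier_nonempty: "a \<in> carrier (burnside_ring G) \<Longrightarrow> a \<noteq> {}"
  using burnside_class_nonempty by (metis burnside_carrierE)

lemma
  assumes "finite (carrier G)" "a \<in> carrier (burnside_ring G)" "(X, Y) \<in> a"
  shows burnside_rep_finite: "finite_gset G X" "finite_gset G Y"
    and burnside_rep_mark: "subgroup H G \<Longrightarrow>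
      burnside_mark a H = int (card (gset_fixed H X)) - int (card (gset_fixed H Y))"
proof -
  have "(X, Y) \<in> marks_class G (burnside_mark a)"
    using assms burnside_eq_marks_class by blast
  then show "finite_gset G X" "finite_gset G Y" "subgroup H G \<Longrightarrow>
      burnside_mark a H = int (card (gset_fixed H X)) - int (card (gset_fixed H Y))"
    by (simp_all add: marks_class_def)
qed

text \<open>For any representatives the marks are those of the expanded product
  \<open>(x1 - y1) * (x2 - y2)\<close>, so all of them yield the same class and the union
  collapses.\<close>

lemma burnside_mult_eq_marks_class:
  assumes G: "finite (carrier G)"
    and a: "a \<in> carrier (burnside_ring G)" and b: "b \<in> carrier (burnside_ring G)"
  shows "a \<otimes>\<^bsub>burnside_ring G\<^esub> b = marks_class G (\<lambda>H. burnside_mark a H * burnside_mark b H)"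
    (is "_ = ?c")
proof -
  have "burnside_class G (gset_sum (gset_prod X1 X2) (gset_prod Y1 Y2))
      (gset_sum (gset_prod X1 Y2) (gset_prod Y1 X2)) = ?c"
    if "(X1, Y1) \<in> a" "(X2, Y2) \<in> b" for X1 Y1 X2 Y2
  proof -
    note 1 = burnside_rep_finite[OF G a that(1)] burnside_rep_mark[OF G a that(1)]
    note 2 = burnside_rep_finite[OF G b that(2)] burnside_rep_mark[OF G b that(2)]
    show ?thesis
      by (subst burnside_class_eq_marks_class[OF G])
        (auto intro!: marks_class_cong finite_gset_sum finite_gset_prod 1(1,2) 2(1,2)
          simp: card_fixed_sum[of G] finite_gset_prod card_fixed_prod 1 2 algebra_simps)
  qed
  then have "a \<otimes>\<^bsub>burnside_ring G\<^esub> b = (\<Union>(X1, Y1)\<in>a. \<Union>(X2, Y2)\<in>b. ?c)"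
    by (simp add: burnside_ring_def case_prod_beta cong: SUP_cong)
  then show ?thesis
    using burnside_carrier_nonempty[OF a] burnside_carrier_nonempty[OF b] by auto
qed

lemma burnside_one_eq_marks_class:
  assumes "group G" "finite (carrier G)"
  shows "\<one>\<^bsub>burnside_ring G\<^esub> = marks_class G (\<lambda>H. 1)"
  by (simp add: burnside_ring_def burnside_class_eq_marks_class assms finite_gset_point
      finite_gset_empty card_fixed_point card_fixed_empty)

text \<open>Not every integer function on subgroups is a mark function, and on an empty set
  \<open>the_elem\<close> says nothing about \<open>\<phi>\<close>; hence the nonemptiness
  assumption.\<close>

lemma burnside_mark_marks_class:
  assumes "marks_class G \<phi> \<noteq> {}" "subgroup H G"
  shows "burnside_mark (marks_class G \<phi>) H = \<phi> H"
proof -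
  have "(\<lambda>(X, Y). int (card (gset_fixed H X)) - int (card (gset_fixed H Y))) ` marks_class G \<phi> =
      (\<lambda>_. \<phi> H) ` marks_class G \<phi>"
    using assms(2) by (intro image_cong) (auto simp: marks_class_def)
  also have "\<dots> = {\<phi> H}" using assms(1) by (simp add: image_constant_conv)
  finally show ?thesis by (simp add: burnside_mark_def)
qed

text \<open>A subgroup \<open>H\<close> acts on a transported G-set through its preimage under
  \<open>\<alpha>\<close>, again a subgroup, so its mark is one of the marks of
  \<open>a\<close>.\<close>

lemma burnside_aut_eq_marks_class:
  assumes G: "group G" "finite (carrier G)" and \<alpha>: "\<alpha> \<in> auto G"
    and a: "a \<in> carrier (burnside_ring G)"
  shows "burnside_aut G \<alpha> a = marks_class G (\<lambda>H. burnside_mark a (inv_into (carrier G) \<alpha> ` H))"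
    (is "_ = ?c")
proof -
  have "burnside_class G (gset_transport G \<alpha> X) (gset_transport G \<alpha> Y) = ?c"
    if "(X, Y) \<in> a" for X Y
  proof -
    note XY = burnside_rep_finite[OF G(2) a that] burnside_rep_mark[OF G(2) a that]
    show ?thesis
      by (subst burnside_class_eq_marks_class[OF G(2)])
        (auto intro!: marks_class_cong finite_gset_transport \<alpha>
          simp: XY gset_fixed_transport auto_subgroup_vimage[OF G(1) \<alpha>])
  qed
  then have "burnside_aut G \<alpha> a = (\<Union>(X, Y)\<in>a. ?c)"
    by (auto simp: burnside_aut_def)
  then show ?thesis using burnside_carrier_nonempty[OF a] by auto
qed

text \<open>Marks are multiplicative, so the mark of a unit is an invertible integer.\<close>

lemma burnside_unit_mark:
  assumes G: "group G" "finite (carrier G)" and u: "u \<in> Units (burnside_ring G)"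
    and H: "subgroup H G"
  shows "burnside_mark u H = 1 \<or> burnside_mark u H = -1"
proof -
  obtain w where uw: "u \<in> carrier (burnside_ring G)" "w \<in> carrier (burnside_ring G)"
    "u \<otimes>\<^bsub>burnside_ring G\<^esub> w = \<one>\<^bsub>burnside_ring G\<^esub>"
    using u by (auto simp: Units_def)
  have mult: "marks_class G (\<lambda>H. burnside_mark u H * burnside_mark w H) = marks_class G (\<lambda>H. 1)"
    using uw burnside_mult_eq_marks_class[OF G(2)] burnside_one_eq_marks_class[OF G] by simp
  have "\<one>\<^bsub>burnside_ring G\<^esub> \<noteq> {}"
    using burnside_class_nonempty[OF finite_gset_point[OF G(1)] finite_gset_empty[OF G(1)]]
    by (simp add: burnside_ring_def)
  then have "marks_class G (\<lambda>H. 1) \<noteq> {}" using burnside_one_eq_marks_class[OF G] by simp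
  then have "burnside_mark u H * burnside_mark w H = 1"
    using burnside_mark_marks_class[OF _ H, of "\<lambda>H. 1"] mult
      burnside_mark_marks_class[OF _ H, of "\<lambda>H. burnside_mark u H * burnside_mark w H"] by simp
  then show ?thesis by (simp add: zmult_eq_1_iff) blast
qed


section \<open>Maximal subgroups of 2-groups\<close>

text \<open>Orbits that are not single fixed points have size dividing \<open>p ^ n\<close> and
  different from 1, hence divisible by \<open>p\<close>; they partition the complement of the fixed
  points.\<close>

lemma card_fixed_prime_power:
  assumes p: "prime p" and X: "finite_gset G X" and ord: "order G = p ^ n"
  shows "p dvd card (gset_fixed (carrier G) X) \<longleftrightarrow> p dvd card (fst X)"
proof -
  interpret group_action G "fst X" "snd X" using X by (simp add: finite_gset_def)
  interpret group G using gset_group[OF X] .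
  let ?F = "gset_fixed (carrier G) X" and ?C = "{c \<in> orbits G (fst X) (snd X). card c \<noteq> 1}"
  have fin: "finite (fst X)" using gset_finite[OF X] .
  have orb1: "card (orbit G (snd X) x) = 1 \<longleftrightarrow> x \<in> ?F" if x: "x \<in> fst X" for x
  proof
    assume "card (orbit G (snd X) x) = 1"
    then have "orbit G (snd X) x = {x}" using orbit_refl[OF x] by (metis card_1_singletonE singletonD)
    then show "x \<in> ?F" using x by (auto simp: gset_fixed_def orbit_def)
  next
    assume "x \<in> ?F"
    then have "orbit G (snd X) x = {x}" using one_closed by (force simp: gset_fixed_def orbit_def)
    then show "card (orbit G (snd X) x) = 1" by simp
  qed
  have "\<Union>?C = fst X - ?F"
  proof (intro subset_antisym subsetI)
    fix z assume "z \<in> \<Union>?C"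
    then obtain x where x: "x \<in> fst X" "z \<in> orbit G (snd X) x" "card (orbit G (snd X) x) \<noteq> 1"
      by (auto simp: orbits_def)
    have z: "z \<in> fst X" using orbit_subset[OF X x(1)] x(2) by blast
    \<comment> \<open>Orbits with a common point coincide, so the orbit of \<open>z\<close> is not a
      single point either.\<close>
    have "x \<in> orbit G (snd X) z" using orbit_sym[OF x(1) z x(2)] .
    then have "orbit G (snd X) z = orbit G (snd X) x"
      using disjoint_union[of "orbit G (snd X) z" "orbit G (snd X) x"] x(1) z orbit_refl[OF x(1)]
      by (auto simp: orbits_def)
    then show "z \<in> fst X - ?F" using orb1[OF z] x(3) z by simp
  next
    fix z assume z: "z \<in> fst X - ?F"
    then have "orbit G (snd X) z \<in> ?C" using orb1[of z] by (auto simp: orbits_def)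
    then show "z \<in> \<Union>?C" using orbit_refl[of z] z by blast
  qed
  moreover have "p dvd card (\<Union>?C)"
  proof (rule dvd_partition)
    show "finite (\<Union>?C)" using fin orbits_coverture by (auto intro: finite_subset)
    show "\<forall>c\<in>?C. p dvd card c"
    proof
      fix c assume "c \<in> ?C"
      then obtain x where x: "x \<in> fst X" "c = orbit G (snd X) x" "card c \<noteq> 1"
        by (auto simp: orbits_def)
      have "card c dvd p ^ n"
        using orbit_stabilizer_theorem[OF x(1)] x(2) ord by (metis dvd_triv_left)
      then show "p dvd card c"
        using x(3) divides_primepow_nat[OF p] by (metis dvd_power power_0 gr0I)
    qed
    show "\<forall>c1\<in>?C. \<forall>c2\<in>?C. c1 \<noteq> c2 \<longrightarrow> c1 \<inter> c2 = {}"
      using disjoint_union by blast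
  qed
  ultimately have "p dvd card (fst X - ?F)" by simp
  moreover have "card (fst X) = card (fst X - ?F) + card ?F"
  proof -
    have "?F \<subseteq> fst X" by (auto simp: gset_fixed_def)
    then show ?thesis using fin by (metis Nat.le_imp_diff_is_add add.commute card_Diff_subset card_mono finite_subset)
  qed
  ultimately show ?thesis by (simp add: dvd_add_right_iff)
qed

text \<open>Normalizers grow in groups of prime power order. Let \<open>M\<close> act on its right
  cosets: \<open>p\<close> divides the index, hence the number of fixed cosets. The coset
  \<open>M\<close> is fixed, so another one, \<open>M g\<close>, is fixed too, and this
  \<open>g\<close> normalizes \<open>M\<close>.\<close>

lemma prime_power_normalizing_element:
  assumes p: "prime p" and "group G" and G: "finite (carrier G)" and ord: "order G = p ^ n"
    and M: "subgroup M G" "M \<noteq> carrier G"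
  obtains g where "g \<in> carrier G - M" "\<And>m. m \<in> M \<Longrightarrow> g \<otimes>\<^bsub>G\<^esub> m \<otimes>\<^bsub>G\<^esub> inv\<^bsub>G\<^esub> g \<in> M"
proof -
  interpret group G by fact
  interpret M: subgroup M G by fact
  \<comment> \<open>The group acting will be \<open>M\<close>. Multiplying by the inverse on the
    right makes this a left action.\<close>
  let ?X = "(rcosets\<^bsub>G\<^esub> M, \<lambda>h. \<lambda>C \<in> rcosets\<^bsub>G\<^esub> M. C #>\<^bsub>G\<^esub> inv\<^bsub>G\<^esub> h)"
  define F where "F = gset_fixed M ?X"
  have lag: "card (rcosets\<^bsub>G\<^esub> M) * card M = p ^ n" using lagrange[OF M(1)] ord by simp
  have fin: "finite (rcosets\<^bsub>G\<^esub> M)"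
    by (rule finite_subset[OF rcosets_subset_PowG[OF M(1)]]) (simp add: G)
  have "finite_gset (G\<lparr>carrier := M\<rparr>) ?X"
    unfolding finite_gset_def fst_conv snd_conv
  proof (intro conjI fin group_actionI subgroup_imp_group[OF M(1)])
    fix h C assume h: "h \<in> carrier (G\<lparr>carrier := M\<rparr>)" and "C \<in> rcosets\<^bsub>G\<^esub> M"
    then obtain a where a: "a \<in> carrier G" "C = M #>\<^bsub>G\<^esub> a" by (auto simp: RCOSETS_def)
    then have closed: "C #>\<^bsub>G\<^esub> inv\<^bsub>G\<^esub> h' \<in> rcosets\<^bsub>G\<^esub> M" if "h' \<in> M" for h'
      using that by (simp add: coset_mult_assoc M.subset rcosetsI)
    then show "(\<lambda>C \<in> rcosets\<^bsub>G\<^esub> M. C #>\<^bsub>G\<^esub> inv\<^bsub>G\<^esub> h) C \<in> rcosets\<^bsub>G\<^esub> M"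
      using h \<open>C \<in> _\<close> by simp
    fix h' assume h': "h' \<in> carrier (G\<lparr>carrier := M\<rparr>)"
    have "C #>\<^bsub>G\<^esub> inv\<^bsub>G\<^esub> (h' \<otimes>\<^bsub>G\<^esub> h) = C #>\<^bsub>G\<^esub> inv\<^bsub>G\<^esub> h #>\<^bsub>G\<^esub> inv\<^bsub>G\<^esub> h'"
      using a h h' by (simp add: coset_mult_assoc M.subset inv_mult_group m_assoc)
    then show "(\<lambda>C \<in> rcosets\<^bsub>G\<^esub> M. C #>\<^bsub>G\<^esub> inv\<^bsub>G\<^esub> (h' \<otimes>\<^bsub>G\<lparr>carrier := M\<rparr>\<^esub> h)) C =
        (\<lambda>C \<in> rcosets\<^bsub>G\<^esub> M. C #>\<^bsub>G\<^esub> inv\<^bsub>G\<^esub> h') ((\<lambda>C \<in> rcosets\<^bsub>G\<^esub> M. C #>\<^bsub>G\<^esub> inv\<^bsub>G\<^esub> h) C)"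
      using closed h \<open>C \<in> _\<close> by simp
  next
    fix C assume "C \<in> rcosets\<^bsub>G\<^esub> M"
    then show "(\<lambda>C \<in> rcosets\<^bsub>G\<^esub> M. C #>\<^bsub>G\<^esub> inv\<^bsub>G\<^esub> \<one>\<^bsub>G\<lparr>carrier := M\<rparr>\<^esub>) C = C"
      using M.rcosets_carrier[OF is_group] by simp
  qed simp
  moreover have "card M dvd p ^ n" using lag by (metis dvd_triv_right)
  then obtain k where "order (G\<lparr>carrier := M\<rparr>) = p ^ k"
    using divides_primepow_nat[OF p] by (auto simp: order_def)
  ultimately have "p dvd card F \<longleftrightarrow> p dvd card (rcosets\<^bsub>G\<^esub> M)"
    using card_fixed_prime_power[OF p] by (fastforce simp: F_def)
  moreover have "p dvd card (rcosets\<^bsub>G\<^esub> M)"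
  proof -
    have "card (rcosets\<^bsub>G\<^esub> M) \<noteq> 1"
    proof
      assume "card (rcosets\<^bsub>G\<^esub> M) = 1"
      then have "card M = card (carrier G)" using lagrange[OF M(1)] by (simp add: order_def)
      then show False using M(2) G M.subset card_subset_eq by blast
    qed
    moreover have "card (rcosets\<^bsub>G\<^esub> M) dvd p ^ n" using lag by (metis dvd_triv_left)
    ultimately show ?thesis
      using divides_primepow_nat[OF p] by (metis dvd_power power_0 gr0I)
  qed
  ultimately have "p dvd card F" by simp
  then have "F \<noteq> {M}" using p by auto
  moreover have "M \<in> F"
  proof -
    have "M = M #>\<^bsub>G\<^esub> \<one>\<^bsub>G\<^esub>" by (simp add: M.subset)
    then have "M \<in> rcosets\<^bsub>G\<^esub> M" using rcosetsI[OF M.subset one_closed] by simp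
    then show ?thesis by (simp add: F_def gset_fixed_def coset_join2[OF _ M(1)])
  qed
  ultimately obtain C where C: "C \<in> F" "C \<noteq> M" by blast
  then obtain g where g: "g \<in> carrier G" "C = M #>\<^bsub>G\<^esub> g" by (auto simp: F_def gset_fixed_def RCOSETS_def)
  have "g \<notin> M" using C(2) g coset_join2[OF g(1) M(1)] by blast
  moreover have "g \<otimes>\<^bsub>G\<^esub> m \<otimes>\<^bsub>G\<^esub> inv\<^bsub>G\<^esub> g \<in> M" if m: "m \<in> M" for m
  proof -
    have "C \<in> rcosets\<^bsub>G\<^esub> M" using C(1) by (simp add: F_def gset_fixed_def)
    then have "\<forall>h\<in>M. C #>\<^bsub>G\<^esub> inv\<^bsub>G\<^esub> h = C" using C(1) by (simp add: F_def gset_fixed_def)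
    \<comment> \<open>Acting by \<open>inv m\<close> multiplies on the right by \<open>m\<close>, so
      \<open>g m\<close> lies in \<open>M g\<close>.\<close>
    then have "C #>\<^bsub>G\<^esub> inv\<^bsub>G\<^esub> (inv\<^bsub>G\<^esub> m) = C" using M.m_inv_closed[OF m] by blast
    then have "M #>\<^bsub>G\<^esub> (g \<otimes>\<^bsub>G\<^esub> m) = M #>\<^bsub>G\<^esub> g"
      using g m by (simp add: coset_mult_assoc M.subset)
    moreover have "g \<otimes>\<^bsub>G\<^esub> m \<in> M #>\<^bsub>G\<^esub> (g \<otimes>\<^bsub>G\<^esub> m)"
      using g m by (intro rcos_self M(1)) simp
    ultimately obtain m' where "m' \<in> M" "g \<otimes>\<^bsub>G\<^esub> m = m' \<otimes>\<^bsub>G\<^esub> g" by (auto simp: r_coset_def)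
    then show ?thesis using g m by (simp add: m_assoc)
  qed
  ultimately show ?thesis using that g(1) by blast
qed

text \<open>A suitable power \<open>k\<close> of a normalizing element lies outside \<open>M\<close> and has its square in \<open>M\<close>;
  by maximality \<open>M \<union> M k\<close> is the whole group.\<close>

lemma maximal_subgroup_mult_iff:
  assumes "group G" and G: "finite (carrier G)" and ord: "order G = 2 ^ n"
    and max: "maximal_subgroup M G"
    and ab: "a \<in> carrier G" "b \<in> carrier G"
  shows "a \<otimes>\<^bsub>G\<^esub> b \<in> M \<longleftrightarrow> (a \<in> M \<longleftrightarrow> b \<in> M)"
proof -
  interpret group G by fact
  have M: "subgroup M G" "M \<noteq> carrier G" using max by (auto simp: maximal_subgroup_def)
  interpret M: subgroup M G by fact
  obtain g where g: "g \<in> carrier G" "g \<notin> M"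
    and norm: "\<And>m. m \<in> M \<Longrightarrow> g \<otimes>\<^bsub>G\<^esub> m \<otimes>\<^bsub>G\<^esub> inv\<^bsub>G\<^esub> g \<in> M"
    using prime_power_normalizing_element[OF two_is_prime_nat \<open>group G\<close> G ord M] by blast
  have pow: "(g [^]\<^bsub>G\<^esub> j) \<otimes>\<^bsub>G\<^esub> m \<otimes>\<^bsub>G\<^esub> inv\<^bsub>G\<^esub> (g [^]\<^bsub>G\<^esub> j) \<in> M" if "m \<in> M" for j :: nat and m
    using that
  proof (induction j arbitrary: m)
    case (Suc j)
    have "(g [^]\<^bsub>G\<^esub> j) \<otimes>\<^bsub>G\<^esub> (g \<otimes>\<^bsub>G\<^esub> m \<otimes>\<^bsub>G\<^esub> inv\<^bsub>G\<^esub> g) \<otimes>\<^bsub>G\<^esub> inv\<^bsub>G\<^esub> (g [^]\<^bsub>G\<^esub> j) \<in> M"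
      by (rule Suc.IH[OF norm[OF Suc.prems]])
    then show ?case using g(1) Suc.prems by (simp add: inv_mult_group m_assoc)
  qed simp
  \<comment> \<open>Squaring \<open>g\<close> repeatedly, \<open>n\<close> times in all, reaches the
    power \<open>2 ^ n\<close>, which is the unit; so some squaring step passes from outside
    \<open>M\<close> into \<open>M\<close>.\<close>
  have "g [^]\<^bsub>G\<^esub> ((2::nat) ^ n) \<in> M" using pow_order_eq_1[OF g(1)] ord by simp
  moreover have "g [^]\<^bsub>G\<^esub> ((2::nat) ^ 0) \<notin> M" using g by simp
  ultimately obtain i where i: "g [^]\<^bsub>G\<^esub> ((2::nat) ^ i) \<notin> M" "g [^]\<^bsub>G\<^esub> ((2::nat) ^ Suc i) \<in> M"
    using inc_induct[of 0 n "\<lambda>i. g [^]\<^bsub>G\<^esub> ((2::nat) ^ i) \<in> M"] by blast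
  define k where "k = g [^]\<^bsub>G\<^esub> ((2::nat) ^ i)"
  have k: "k \<in> carrier G" "k \<notin> M" using g i by (simp_all add: k_def)
  have kk: "k \<otimes>\<^bsub>G\<^esub> k \<in> M"
    using i(2) g by (simp add: k_def nat_pow_mult mult_2)
  have conj: "k \<otimes>\<^bsub>G\<^esub> m \<otimes>\<^bsub>G\<^esub> inv\<^bsub>G\<^esub> k \<in> M" if "m \<in> M" for m
    using pow[OF that] by (simp add: k_def)
  have cancel: "inv\<^bsub>G\<^esub> k \<otimes>\<^bsub>G\<^esub> (k \<otimes>\<^bsub>G\<^esub> x) = x" if "x \<in> carrier G" for x
    using that k(1) by (simp flip: m_assoc)
  have MkMk: "(m \<otimes>\<^bsub>G\<^esub> k) \<otimes>\<^bsub>G\<^esub> (m' \<otimes>\<^bsub>G\<^esub> k) \<in> M" if "m \<in> M" "m' \<in> M" for m m'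
  proof -
    \<comment> \<open>Conjugation moves \<open>k\<close> past \<open>m'\<close>:
      \<open>m k m' k = m (k m' k^-1) (k k)\<close>.\<close>
    have "m \<otimes>\<^bsub>G\<^esub> (k \<otimes>\<^bsub>G\<^esub> m' \<otimes>\<^bsub>G\<^esub> inv\<^bsub>G\<^esub> k) \<otimes>\<^bsub>G\<^esub> (k \<otimes>\<^bsub>G\<^esub> k) \<in> M"
      using that conj kk by simp
    then show ?thesis using that k(1) cancel by (simp add: m_assoc)
  qed
  have "subgroup (M \<union> (M #>\<^bsub>G\<^esub> k)) G"
  proof (rule subgroupI)
    show "M \<union> (M #>\<^bsub>G\<^esub> k) \<subseteq> carrier G"
      using k(1) M.subset by (simp add: r_coset_subset_G)
    show "M \<union> (M #>\<^bsub>G\<^esub> k) \<noteq> {}" using M.one_closed by blast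
  next
    fix a assume "a \<in> M \<union> (M #>\<^bsub>G\<^esub> k)"
    then consider "a \<in> M" | m where "m \<in> M" "a = m \<otimes>\<^bsub>G\<^esub> k" by (auto simp: r_coset_def)
    then show "inv\<^bsub>G\<^esub> a \<in> M \<union> (M #>\<^bsub>G\<^esub> k)"
    proof cases
      case 2
      \<comment> \<open>To land in \<open>M k\<close>, write
        \<open>k^-1 m^-1 = (k k)^-1 (k m^-1 k^-1) k\<close>.\<close>
      have "inv\<^bsub>G\<^esub> (k \<otimes>\<^bsub>G\<^esub> k) \<otimes>\<^bsub>G\<^esub> (k \<otimes>\<^bsub>G\<^esub> inv\<^bsub>G\<^esub> m \<otimes>\<^bsub>G\<^esub> inv\<^bsub>G\<^esub> k) \<in> M"
        using kk conj 2(1) by simp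
      moreover have "inv\<^bsub>G\<^esub> a =
          inv\<^bsub>G\<^esub> (k \<otimes>\<^bsub>G\<^esub> k) \<otimes>\<^bsub>G\<^esub> (k \<otimes>\<^bsub>G\<^esub> inv\<^bsub>G\<^esub> m \<otimes>\<^bsub>G\<^esub> inv\<^bsub>G\<^esub> k) \<otimes>\<^bsub>G\<^esub> k"
        using 2 k(1) cancel by (simp add: inv_mult_group m_assoc)
      ultimately show ?thesis by (auto simp: r_coset_def)
    qed simp
  next
    fix a b assume "a \<in> M \<union> (M #>\<^bsub>G\<^esub> k)" and b: "b \<in> M \<union> (M #>\<^bsub>G\<^esub> k)"
    then consider "a \<in> M" | m where "m \<in> M" "a = m \<otimes>\<^bsub>G\<^esub> k" by (auto simp: r_coset_def)
    then show "a \<otimes>\<^bsub>G\<^esub> b \<in> M \<union> (M #>\<^bsub>G\<^esub> k)"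
    proof cases
      case 1
      show ?thesis
      proof (cases "b \<in> M")
        case False
        then obtain m where m: "m \<in> M" "b = m \<otimes>\<^bsub>G\<^esub> k" using b by (auto simp: r_coset_def)
        then have "a \<otimes>\<^bsub>G\<^esub> b = (a \<otimes>\<^bsub>G\<^esub> m) \<otimes>\<^bsub>G\<^esub> k" using 1 k(1) by (simp add: m_assoc)
        then show ?thesis using 1 m by (auto simp: r_coset_def)
      qed (use 1 in simp)
    next
      case 2
      show ?thesis
      proof (cases "b \<in> M")
        case True
        have "a \<otimes>\<^bsub>G\<^esub> b = m \<otimes>\<^bsub>G\<^esub> (k \<otimes>\<^bsub>G\<^esub> b \<otimes>\<^bsub>G\<^esub> inv\<^bsub>G\<^esub> k) \<otimes>\<^bsub>G\<^esub> k"
          using 2 k(1) True by (simp add: m_assoc)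
        moreover have "m \<otimes>\<^bsub>G\<^esub> (k \<otimes>\<^bsub>G\<^esub> b \<otimes>\<^bsub>G\<^esub> inv\<^bsub>G\<^esub> k) \<in> M" using 2 conj True by simp
        ultimately show ?thesis by (auto simp: r_coset_def)
      next
        case False
        then show ?thesis using b MkMk 2 by (auto simp: r_coset_def)
      qed
    qed
  qed
  \<comment> \<open>This makes the union strictly larger than \<open>M\<close>, so maximality leaves
    only the whole group.\<close>
  moreover have "k \<in> M #>\<^bsub>G\<^esub> k" using rcos_self[OF k(1) M(1)] .
  ultimately have G_eq: "carrier G = M \<union> (M #>\<^bsub>G\<^esub> k)"
    using max k(2) unfolding maximal_subgroup_def by blast
  show ?thesis
  proof (cases "a \<in> M")
    case True
    then have "b \<in> M" if "a \<otimes>\<^bsub>G\<^esub> b \<in> M"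
      using M.m_closed[OF M.m_inv_closed[OF True] that] ab by (simp flip: m_assoc)
    then show ?thesis using True by blast
  next
    case False
    then have "a \<otimes>\<^bsub>G\<^esub> b \<notin> M" if "b \<in> M"
      using M.m_closed[OF _ M.m_inv_closed[OF that], of "a \<otimes>\<^bsub>G\<^esub> b"] ab by (auto simp: m_assoc)
    \<comment> \<open>Elements outside \<open>M\<close> all lie in the coset \<open>M k\<close>, and
      a product of two such elements falls into \<open>M\<close>.\<close>
    moreover have "a \<otimes>\<^bsub>G\<^esub> b \<in> M" if "b \<notin> M"
      using that False ab MkMk unfolding G_eq by (auto simp: r_coset_def)
    ultimately show ?thesis using False by blast
  qed
qed

text \<open>A subgroup above the image pulls back along the inverse to one above \<open>M\<close>,
  where maximality applies; pushing forward again recovers it.\<close>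

lemma maximal_subgroup_auto_image:
  assumes G: "group G" and \<alpha>: "\<alpha> \<in> auto G" and max: "maximal_subgroup M G"
  shows "maximal_subgroup (\<alpha> ` M) G"
proof -
  let ?\<beta> = "inv_into (carrier G) \<alpha>"
  have bij: "bij_betw \<alpha> (carrier G) (carrier G)" using \<alpha> by (simp add: auto_def Bij_def)
  have M: "subgroup M G" "M \<noteq> carrier G" using max by (auto simp: maximal_subgroup_def)
  have Mc: "M \<subseteq> carrier G" using M(1) by (rule subgroup.subset)
  have inv: "?\<beta> ` \<alpha> ` A = A" "\<alpha> ` ?\<beta> ` A = A" if "A \<subseteq> carrier G" for A
    using that bij by (simp_all add: bij_betw_def image_inv_into_cancel inv_into_image_cancel)
  have "\<alpha> ` M \<noteq> carrier G"
    using inv(1)[OF Mc] inv(1)[OF subset_refl] bij M(2) by (metis bij_betw_def)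
  moreover have "H = \<alpha> ` M \<or> H = carrier G" if H: "subgroup H G" and le: "\<alpha> ` M \<subseteq> H" for H
  proof -
    have Hc: "H \<subseteq> carrier G" using H by (rule subgroup.subset)
    have "M \<subseteq> ?\<beta> ` H" using image_mono[OF le, of ?\<beta>] inv(1)[OF Mc] by simp
    then have "?\<beta> ` H = M \<or> ?\<beta> ` H = carrier G"
      using max auto_subgroup_vimage[OF G \<alpha> H] by (simp add: maximal_subgroup_def)
    then show ?thesis using inv(2)[OF Hc] bij by (auto simp: bij_betw_def)
  qed
  ultimately show ?thesis
    using auto_subgroup_image[OF G \<alpha> M(1)] by (simp add: maximal_subgroup_def)
qed


section \<open>The units attached to maximal subgroups\<close>

text \<open>A copy of \<open>G/M\<close> for a subgroup \<open>M\<close> of index two.\<close>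

definition index2_gset :: "'g set \<Rightarrow> ('g, bool) gset" where
  "index2_gset M = (UNIV, \<lambda>g b. b \<longleftrightarrow> g \<in> M)"

text \<open>Elements of \<open>M\<close> fix both booleans and all others swap them.\<close>

lemma card_fixed_index2: "card (gset_fixed H (index2_gset M)) = (if H \<subseteq> M then 2 else 0)"
proof -
  have "gset_fixed H (index2_gset M) = (if H \<subseteq> M then UNIV else {})"
    by (auto simp: gset_fixed_def index2_gset_def)
  then show ?thesis by (simp add: card_UNIV_bool)
qed

text \<open>With two points, multiplicativity of the action is the law \<open>g h \<in> M
  \<longleftrightarrow> (g \<in> M \<longleftrightarrow> h \<in> M)\<close>, which expresses index
  two.\<close>

lemma finite_index2_gset:
  assumes G: "group G" "finite (carrier G)" "order G = 2 ^ n" and M: "maximal_subgroup M G"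
  shows "finite_gset G (index2_gset M)"
proof -
  have "\<one>\<^bsub>G\<^esub> \<in> M" using M by (simp add: maximal_subgroup_def subgroup.one_closed)
  then have "group_action G UNIV (\<lambda>g b. b \<longleftrightarrow> g \<in> M)"
    by (intro group_actionI G) (auto simp: maximal_subgroup_mult_iff[OF G M])
  then show ?thesis by (simp add: finite_gset_def index2_gset_def)
qed

lemma maximal_subgroup_unit:
  assumes G: "group G" "finite (carrier G)" "order G = 2 ^ n" and M: "maximal_subgroup M G"
  shows "\<exists>v \<in> Units (burnside_ring G).
    \<forall>P. subgroup P G \<longrightarrow> (burnside_mark v P = -1 \<longleftrightarrow> P \<subseteq> M)"
proof -
  let ?v = "burnside_class G gset_point (index2_gset M)"
  note fin = finite_gset_point[OF G(1)] finite_index2_gset[OF G M]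
  have mark: "burnside_mark ?v P = (if P \<subseteq> M then -1 else 1)" if "subgroup P G" for P
    using burnside_mark_class[OF fin subgroup.subset[OF that]]
    by (simp add: card_fixed_point card_fixed_index2)
  have v: "?v \<in> carrier (burnside_ring G)" by (rule burnside_class_in_carrier[OF G(2) fin])
  \<comment> \<open>All marks of \<open>?v\<close> are 1 or -1, so its square has the marks of the
    ring unit.\<close>
  have "?v \<otimes>\<^bsub>burnside_ring G\<^esub> ?v = \<one>\<^bsub>burnside_ring G\<^esub>"
    unfolding burnside_mult_eq_marks_class[OF G(2) v v] burnside_one_eq_marks_class[OF G(1,2)]
    by (rule marks_class_cong) (simp add: mark)
  then have "?v \<in> Units (burnside_ring G)" using v by (auto simp: Units_def)
  then show ?thesis using mark by (intro bexI[of _ ?v]) auto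
qed

text \<open>The right-hand side no longer mentions \<open>u\<close>, so two units satisfying the
  same condition are equal through it.\<close>

lemma burnside_unit_eq_marks_class:
  assumes G: "group G" "finite (carrier G)" and u: "u \<in> Units (burnside_ring G)"
    and neg: "\<And>P. subgroup P G \<Longrightarrow> burnside_mark u P = -1 \<longleftrightarrow> P \<subseteq> M"
  shows "u = marks_class G (\<lambda>P. if P \<subseteq> M then -1 else 1)"
proof -
  have "u = marks_class G (burnside_mark u)"
    using u by (intro burnside_eq_marks_class[OF G(2)]) (simp add: Units_def)
  also have "\<dots> = marks_class G (\<lambda>P. if P \<subseteq> M then -1 else 1)"
    using burnside_unit_mark[OF G u] neg by (intro marks_class_cong) auto
  finally show ?thesis .
qed

lemma burnside_aut_unit:
  assumes G: "group G" "finite (carrier G)" and \<alpha>: "\<alpha> \<in> auto G" and M: "M \<subseteq> carrier G"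
    and u: "u \<in> Units (burnside_ring G)"
    and neg: "\<And>P. subgroup P G \<Longrightarrow> burnside_mark u P = -1 \<longleftrightarrow> P \<subseteq> M"
  shows "burnside_aut G \<alpha> u = marks_class G (\<lambda>P. if P \<subseteq> \<alpha> ` M then -1 else 1)"
proof -
  let ?\<beta> = "inv_into (carrier G) \<alpha>"
  have bij: "bij_betw \<alpha> (carrier G) (carrier G)" using \<alpha> by (simp add: auto_def Bij_def)
  have "burnside_aut G \<alpha> u = marks_class G (\<lambda>P. burnside_mark u (?\<beta> ` P))"
    using u by (intro burnside_aut_eq_marks_class[OF G \<alpha>]) (simp add: Units_def)
  also have "\<dots> = marks_class G (\<lambda>P. if P \<subseteq> \<alpha> ` M then -1 else 1)"
  proof (rule marks_class_cong)
    fix P assume P: "subgroup P G"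
    have "?\<beta> ` \<alpha> ` M = M" "\<alpha> ` ?\<beta> ` P = P"
      using M subgroup.subset[OF P] bij
      by (simp_all add: bij_betw_def image_inv_into_cancel inv_into_image_cancel)
    \<comment> \<open>Both maps preserve inclusions and undo each other on the sets
      involved.\<close>
    then have "?\<beta> ` P \<subseteq> M \<longleftrightarrow> P \<subseteq> \<alpha> ` M" by (metis image_mono)
    then show "burnside_mark u (?\<beta> ` P) = (if P \<subseteq> \<alpha> ` M then -1 else 1)"
      using burnside_unit_mark[OF G u] neg auto_subgroup_vimage[OF G(1) \<alpha> P] by auto
  qed
  finally show ?thesis .
qed

text \<open>The second part concerns every choice function \<open>v\<close>, not one construction,
  so it rests on uniqueness: both sides of the equation for \<open>v M\<close> equal the same
  \<open>marks_class\<close>.\<close>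

theorem proposition8p1:
  fixes S :: "('a, 'b) monoid_scheme"
  assumes "group S" and "finite (carrier S)" and "\<exists>n. order S = 2 ^ n"
  shows "(\<forall>M. maximal_subgroup M S \<longrightarrow>
            (\<exists>v \<in> Units (burnside_ring S).
               \<forall>P. subgroup P S \<longrightarrow> (burnside_mark v P = -1 \<longleftrightarrow> P \<subseteq> M))) \<and>
         (\<forall>v. (\<forall>M. maximal_subgroup M S \<longrightarrow>
                  v M \<in> Units (burnside_ring S) \<and>
                  (\<forall>P. subgroup P S \<longrightarrow> (burnside_mark (v M) P = -1 \<longleftrightarrow> P \<subseteq> M))) \<longrightarrow>
              group_action (AutoGroup S) (v ` {M. maximal_subgroup M S})
                (\<lambda>\<alpha>. \<lambda>x \<in> v ` {M. maximal_subgroup M S}. burnside_aut S \<alpha> x) \<and>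
              (\<forall>\<alpha> \<in> auto S. \<forall>M. maximal_subgroup M S \<longrightarrow>
                 maximal_subgroup (\<alpha> ` M) S \<and> burnside_aut S \<alpha> (v M) = v (\<alpha> ` M)))"
proof (intro conjI allI impI)
  fix M assume "maximal_subgroup M S"
  then show "\<exists>v \<in> Units (burnside_ring S).
      \<forall>P. subgroup P S \<longrightarrow> (burnside_mark v P = -1 \<longleftrightarrow> P \<subseteq> M)"
    using maximal_subgroup_unit assms by blast
next
  fix v assume v: "\<forall>M. maximal_subgroup M S \<longrightarrow> v M \<in> Units (burnside_ring S) \<and>
      (\<forall>P. subgroup P S \<longrightarrow> (burnside_mark (v M) P = -1 \<longleftrightarrow> P \<subseteq> M))"
  have sub: "M \<subseteq> carrier S" if "maximal_subgroup M S" for M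
    using that by (auto simp: maximal_subgroup_def dest: subgroup.subset)
  note max = maximal_subgroup_auto_image[OF assms(1)]
  have act: "burnside_aut S \<alpha> (v M) = v (\<alpha> ` M)" if "\<alpha> \<in> auto S" "maximal_subgroup M S" for \<alpha> M
  proof -
    have "burnside_aut S \<alpha> (v M) = marks_class S (\<lambda>P. if P \<subseteq> \<alpha> ` M then -1 else 1)"
      using v that sub by (intro burnside_aut_unit[OF assms(1,2)]) auto
    also have "\<dots> = v (\<alpha> ` M)"
      using v max[OF that] by (intro burnside_unit_eq_marks_class[OF assms(1,2), symmetric]) auto
    finally show ?thesis .
  qed
  then show "\<forall>\<alpha> \<in> auto S. \<forall>M. maximal_subgroup M S \<longrightarrow>
      maximal_subgroup (\<alpha> ` M) S \<and> burnside_aut S \<alpha> (v M) = v (\<alpha> ` M)"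
    using max by blast
  \<comment> \<open>Automorphisms are extensional maps: unit and product of \<open>AutoGroup\<close>
    are identity and composition cut down to the carrier. On subsets of the carrier the cut is
    invisible, which is what \<open>sub\<close> serves for below.\<close>
  have Aut: "carrier (AutoGroup S) = auto S" "\<one>\<^bsub>AutoGroup S\<^esub> = (\<lambda>x\<in>carrier S. x)"
    "\<And>\<alpha> \<beta>. \<alpha> \<in> auto S \<Longrightarrow> \<beta> \<in> auto S \<Longrightarrow> \<alpha> \<otimes>\<^bsub>AutoGroup S\<^esub> \<beta> = compose (carrier S) \<alpha> \<beta>"
    by (simp_all add: AutoGroup_def BijGroup_def auto_def)
  show "group_action (AutoGroup S) (v ` {M. maximal_subgroup M S})
      (\<lambda>\<alpha>. \<lambda>x \<in> v ` {M. maximal_subgroup M S}. burnside_aut S \<alpha> x)"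
    (is "group_action _ ?E ?\<phi>")
  proof (rule group_actionI)
    show "group (AutoGroup S)" by (rule group.AutoGroup[OF assms(1)])
    show "?\<phi> \<alpha> x \<in> ?E" if "\<alpha> \<in> carrier (AutoGroup S)" "x \<in> ?E" for \<alpha> x
      using that act max by (auto simp: Aut)
    show "?\<phi> \<one>\<^bsub>AutoGroup S\<^esub> x = x" if "x \<in> ?E" for x
    proof -
      obtain M where M: "maximal_subgroup M S" "x = v M" using \<open>x \<in> ?E\<close> by blast
      have "(\<lambda>x\<in>carrier S. x) ` M = M" using sub[OF M(1)] by (auto simp: subset_iff image_iff)
      then show ?thesis
        using act[OF group.id_in_auto[OF assms(1)] M(1)] M \<open>x \<in> ?E\<close> by (simp add: Aut)
    qed
    show "?\<phi> (\<alpha> \<otimes>\<^bsub>AutoGroup S\<^esub> \<beta>) x = ?\<phi> \<alpha> (?\<phi> \<beta> x)"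
      if "\<alpha> \<in> carrier (AutoGroup S)" "\<beta> \<in> carrier (AutoGroup S)" "x \<in> ?E" for \<alpha> \<beta> x
    proof -
      have \<alpha>\<beta>: "\<alpha> \<in> auto S" "\<beta> \<in> auto S" using that by (simp_all add: Aut)
      obtain M where M: "maximal_subgroup M S" "x = v M" using \<open>x \<in> ?E\<close> by blast
      \<comment> \<open>Closure under composition holds since \<open>auto S\<close> is a subgroup of
        the group of bijections.\<close>
      have "compose (carrier S) \<alpha> \<beta> \<in> auto S"
        using group.subgroup_auto[OF assms(1)] \<alpha>\<beta> subgroup.m_closed
        by (fastforce simp: BijGroup_def auto_def)
      then have "burnside_aut S (compose (carrier S) \<alpha> \<beta>) (v M) = v (compose (carrier S) \<alpha> \<beta> ` M)"
        using act M(1) by blast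
      moreover have "compose (carrier S) \<alpha> \<beta> ` M = \<alpha> ` \<beta> ` M"
        using sub[OF M(1)] by (auto simp: compose_def subset_iff image_iff)
      moreover have "burnside_aut S \<beta> (v M) = v (\<beta> ` M)" "burnside_aut S \<alpha> (v (\<beta> ` M)) = v (\<alpha> ` \<beta> ` M)"
        using act \<alpha>\<beta> M(1) max by blast+
      moreover have "v (\<beta> ` M) \<in> ?E" using max[OF \<alpha>\<beta>(2) M(1)] by blast
      ultimately show ?thesis using M that(3) \<alpha>\<beta> by (simp add: Aut)
    qed
  qed simp
qed

end
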